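(* Every $3$-uniform hypergraph without cut edges is quasi-eulerian.
   Context: A hypergraph $H=(V,E)$ consists of a finite nonempty vertex set $V$, a finite edge set $E$ disjoint from $V$, and an incidence function assigning to each edge $e\in E$ a subset of $V$ (also denoted $e$); distinct edges may have the same vertex set. $H$ is $3$-uniform if $|e|=3$ for all $e\in E$. A walk is a sequence $W=v_0e_1v_1e_2\cdots e_kv_k$ with $v_i\in V$, $e_i\in E$, such that for each $i$, $v_{i-1}\ne v_i$ and $v_{i-1},v_i\in e_i$; the $v_i$ are its anchors. $W$ is closed if $k\ge 2$ and $v_0=v_k$; it is a strict trail if $e_1,\dots,e_k$ are pairwise distinct. An Euler family of $H$ is a family of closed strict trails such that every edge of $H$ lies in exactly one trail and no two trails have a common anchor; $H$ is quasi-eulerian if it has one. Connectivity is defined via walks; $\mathrm{cc}(H)$ is the number of connected components of $H$ (isolated vertices count as components). For $e\in E$, $H-e=(V,E\setminus\{e\})$, and $e$ is a cut edge if $\mathrm{cc}(H-e)>\mathrm{cc}(H)$. *)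

theory Defs
  imports Main
begin

text \<open>A hypergraph is given by a vertex set V (of type 'v), an edge set E (of a
separate type 'e, so V and E are disjoint), and an incidence function inc.
Distinct edges may have the same vertex set.\<close>

definition hypergraph :: "'v set \<Rightarrow> 'e set \<Rightarrow> ('e \<Rightarrow> 'v set) \<Rightarrow> bool" where
  "hypergraph V E inc \<longleftrightarrow> finite V \<and> V \<noteq> {} \<and> finite E \<and> (\<forall>e\<in>E. inc e \<subseteq> V)"

definition three_uniform :: "'e set \<Rightarrow> ('e \<Rightarrow> 'v set) \<Rightarrow> bool" where
  "three_uniform E inc \<longleftrightarrow> (\<forall>e\<in>E. card (inc e) = 3)"

text \<open>A walk v0 e1 v1 ... ek vk is represented by its anchor list vs = [v0,...,vk]
and edge list es = [e1,...,ek].\<close>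

definition walk :: "'v set \<Rightarrow> 'e set \<Rightarrow> ('e \<Rightarrow> 'v set) \<Rightarrow> 'v list \<Rightarrow> 'e list \<Rightarrow> bool" where
  "walk V E inc vs es \<longleftrightarrow>
     length vs = Suc (length es) \<and> set vs \<subseteq> V \<and> set es \<subseteq> E \<and>
     (\<forall>i < length es. vs ! i \<noteq> vs ! Suc i \<and> vs ! i \<in> inc (es ! i) \<and> vs ! Suc i \<in> inc (es ! i))"

definition closed_walk :: "'v set \<Rightarrow> 'e set \<Rightarrow> ('e \<Rightarrow> 'v set) \<Rightarrow> 'v list \<Rightarrow> 'e list \<Rightarrow> bool" where
  "closed_walk V E inc vs es \<longleftrightarrow> walk V E inc vs es \<and> length es \<ge> 2 \<and> hd vs = last vs"

definition closed_strict_trail :: "'v set \<Rightarrow> 'e set \<Rightarrow> ('e \<Rightarrow> 'v set) \<Rightarrow> 'v list \<Rightarrow> 'e list \<Rightarrow> bool" where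
  "closed_strict_trail V E inc vs es \<longleftrightarrow> closed_walk V E inc vs es \<and> distinct es"

definition euler_family :: "'v set \<Rightarrow> 'e set \<Rightarrow> ('e \<Rightarrow> 'v set) \<Rightarrow> ('v list \<times> 'e list) set \<Rightarrow> bool" where
  "euler_family V E inc F \<longleftrightarrow>
     (\<forall>T\<in>F. closed_strict_trail V E inc (fst T) (snd T)) \<and>
     (\<forall>e\<in>E. \<exists>!T. T \<in> F \<and> e \<in> set (snd T)) \<and>
     (\<forall>T1\<in>F. \<forall>T2\<in>F. T1 \<noteq> T2 \<longrightarrow> set (fst T1) \<inter> set (fst T2) = {})"

definition quasi_eulerian :: "'v set \<Rightarrow> 'e set \<Rightarrow> ('e \<Rightarrow> 'v set) \<Rightarrow> bool" where
  "quasi_eulerian V E inc \<longleftrightarrow> (\<exists>F. euler_family V E inc F)"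

definition connected_by_walk :: "'v set \<Rightarrow> 'e set \<Rightarrow> ('e \<Rightarrow> 'v set) \<Rightarrow> 'v \<Rightarrow> 'v \<Rightarrow> bool" where
  "connected_by_walk V E inc u v \<longleftrightarrow> (\<exists>vs es. walk V E inc vs es \<and> hd vs = u \<and> last vs = v)"

text \<open>Number of connected components: number of classes of vertices under walk-connectivity
(isolated vertices form their own components).\<close>

definition num_components :: "'v set \<Rightarrow> 'e set \<Rightarrow> ('e \<Rightarrow> 'v set) \<Rightarrow> nat" where
  "num_components V E inc = card ((\<lambda>u. {v \<in> V. connected_by_walk V E inc u v}) ` V)"

definition cut_edge :: "'v set \<Rightarrow> 'e set \<Rightarrow> ('e \<Rightarrow> 'v set) \<Rightarrow> 'e \<Rightarrow> bool" where
  "cut_edge V E inc e \<longleftrightarrow> e \<in> E \<and> num_components V (E - {e}) inc > num_components V E inc"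

end

theory Submission
  imports Defs
begin

text \<open>An Euler family amounts to choosing for every edge one vertex to omit, so that the remaining pairs
form a graph with even degrees: each vertex must be omitted as often, modulo 2, as it lies in edges.
The obstruction is of Tutte--Berge type: if a choice with the fewest defects (vertices of wrong
parity and edges without a choice) still has \<open>k\<close> defects, then there are a set \<open>A\<close> of edges and at least
\<open>|A| + k\<close> disjoint unions \<open>C\<close> of components of \<open>H - A\<close> in which the demands of the vertices and the
number of edges add up to an odd number. An edge which is never
defective in an optimal choice is put into \<open>A\<close> and removed; if there is none, an argument in the
manner of Gallai's lemma shows that defects lie in distinct components. By 3-uniformity, this
oddness means an odd number of incidences between \<open>C\<close> and \<open>A\<close>. A single incidence would give a cut edge, so there
are at least three, and counting the \<open>3|A|\<close> incidences of \<open>A\<close> yields \<open>k = 0\<close>.\<close>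

subsection \<open>Vertex selections with prescribed parities\<close>

definition defects :: "'e set \<Rightarrow> ('w \<Rightarrow> nat) \<Rightarrow> ('e \<Rightarrow> 'w) \<Rightarrow> 'w set" where
  "defects E t f = {w. odd (card {e \<in> E. f e = w} + t w)}"

text \<open>Only the fibres over the old and the new value at \<open>e\<close> change, each by one,
  so exactly these two parities flip.\<close>

lemma defects_upd:
  assumes "finite E" "e \<in> E" "f e \<noteq> b"
  shows "defects E t (f(e := b)) = sym_diff (defects E t f) {f e, b}"
proof -
  have b: "{e' \<in> E. (f(e := b)) e' = b} = insert e {e' \<in> E. f e' = b}"
    using assms by auto
  have a: "{e' \<in> E. f e' = f e} = insert e {e' \<in> E. (f(e := b)) e' = f e}"
    using assms by auto
  have o: "{e' \<in> E. (f(e := b)) e' = w} = {e' \<in> E. f e' = w}" if "w \<noteq> b" "w \<noteq> f e" for w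
    using that by auto
  have cb: "card {e' \<in> E. (f(e := b)) e' = b} = Suc (card {e' \<in> E. f e' = b})"
    unfolding b using assms by (subst card_insert_disjoint) auto
  have ca: "card {e' \<in> E. f e' = f e} = Suc (card {e' \<in> E. (f(e := b)) e' = f e})"
    by (subst a, subst card_insert_disjoint) (use assms in auto)
  have "w \<in> defects E t (f(e := b)) \<longleftrightarrow> (w \<in> defects E t f) \<noteq> (w = f e \<or> w = b)" for w
  proof -
    consider "w = b" | "w = f e" | "w \<noteq> b" "w \<noteq> f e" by blast
    then show ?thesis
    proof cases
      case 3
      then show ?thesis using o[of w] unfolding defects_def mem_Collect_eq by simp
    next
      case 1
      then show ?thesis using cb unfolding defects_def by (simp del: fun_upd_apply)
    next
      case 2
      show ?thesis unfolding 2 defects_def mem_Collect_eq using ca by presburger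
    qed
  qed
  then show ?thesis by auto
qed

text \<open>View each \<open>e\<close> with \<open>f e \<noteq> f' e\<close> as a graph edge joining
  \<open>f e\<close> and \<open>f' e\<close>. The defect sets differ in the vertices of odd degree,
  so a trail starting at \<open>y\<close> can be followed to another such vertex \<open>c\<close>.
  Switching the choices along it, in \<open>f\<close> and in \<open>f'\<close>, changes both defect
  sets by \<open>{y, c}\<close>.\<close>

lemma defects_exchange:
  assumes "finite E" "y \<in> sym_diff (defects E t f) (defects E t f')"
  shows "\<exists>c g g'. c \<noteq> y \<and> c \<in> sym_diff (defects E t f) (defects E t f') \<and>
    (\<forall>e\<in>E. g e \<in> {f e, f' e} \<and> g' e \<in> {f e, f' e}) \<and>
    defects E t g = sym_diff (defects E t f) {y, c} \<and>
    defects E t g' = sym_diff (defects E t f') {y, c}"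
  using assms(2)
proof (induction "card {e \<in> E. f e \<noteq> f' e}" arbitrary: f y rule: less_induct)
  case less
  let ?T = "defects E t"
  have "card {e \<in> E. f e = y} \<noteq> card {e \<in> E. f' e = y}"
    using less.prems unfolding defects_def by auto
  then have "\<not> (\<forall>e\<in>E. f e = y \<longleftrightarrow> f' e = y)" by (metis (mono_tags, lifting) Collect_cong)
  then obtain e where e: "e \<in> E" "f e \<noteq> f' e" "y = f e \<or> y = f' e" by metis
  \<comment> \<open>The other end of the edge \<open>e\<close> at \<open>y\<close>, that is, the
    next vertex of the trail.\<close>
  define z where "z = (if y = f e then f' e else f e)"
  have yz: "{f e, f' e} = {y, z}" "z \<noteq> y" using e by (auto simp: z_def)
  let ?f1 = "f(e := f' e)"
  have T1: "?T ?f1 = sym_diff (?T f) {y, z}"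
    using defects_upd[OF assms(1) e(1), of f "f' e" t] e(2) yz by simp
  show ?case
  proof (cases "z \<in> sym_diff (?T f) (?T f')")
    case True
    have T1': "?T (f'(e := f e)) = sym_diff (?T f') {y, z}"
      using defects_upd[OF assms(1) e(1), of f' "f e" t] e yz by (simp add: insert_commute)
    have "\<forall>d\<in>E. ?f1 d \<in> {f d, f' d} \<and> (f'(e := f e)) d \<in> {f d, f' d}" by simp
    then show ?thesis
      by (intro exI[of _ z] exI[of _ ?f1] exI[of _ "f'(e := f e)"] conjI yz(2) True T1 T1')
  next
    \<comment> \<open>Switch \<open>e\<close> in \<open>f\<close> and continue from
      \<open>z\<close>, which now has odd degree. The resulting \<open>g'\<close> still agrees with
      \<open>f'\<close> at \<open>e\<close>, so it can be switched there afterwards.\<close>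
    case False
    have "{e \<in> E. ?f1 e \<noteq> f' e} \<subset> {e \<in> E. f e \<noteq> f' e}" using e by auto
    then have lt: "card {e \<in> E. ?f1 e \<noteq> f' e} < card {e \<in> E. f e \<noteq> f' e}"
      by (rule psubset_card_mono[rotated]) (use assms(1) in auto)
    have "z \<in> sym_diff (?T ?f1) (?T f')" using False T1 by auto
    from less.hyps[OF lt this] obtain c g g' where
      c: "c \<noteq> z" "c \<in> sym_diff (?T ?f1) (?T f')"
      and g: "\<forall>e\<in>E. g e \<in> {?f1 e, f' e} \<and> g' e \<in> {?f1 e, f' e}"
      and Tg: "?T g = sym_diff (?T ?f1) {z, c}" "?T g' = sym_diff (?T f') {z, c}" by blast
    have g'e: "g' e = f' e" using g e(1) by auto
    have c': "c \<in> sym_diff (?T f) (?T f')" "c \<noteq> y" using c T1 less.prems by auto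
    have 1: "?T g = sym_diff (?T f) {y, c}" using Tg(1) T1 yz c(1) c'(2) by auto
    have "?T (g'(e := f e)) = sym_diff (?T g') {y, z}"
      using defects_upd[OF assms(1) e(1), of g' "f e" t] e yz g'e by (simp add: insert_commute)
    then have 2: "?T (g'(e := f e)) = sym_diff (?T f') {y, c}" using Tg(2) yz c(1) c'(2) by auto
    have 3: "\<forall>d\<in>E. g d \<in> {f d, f' d} \<and> (g'(e := f e)) d \<in> {f d, f' d}"
    proof
      fix d assume "d \<in> E"
      with g have "g d \<in> {?f1 d, f' d}" "g' d \<in> {?f1 d, f' d}" by blast+
      then show "g d \<in> {f d, f' d} \<and> (g'(e := f e)) d \<in> {f d, f' d}" by (cases "d = e") auto
    qed
    show ?thesis
      by (intro exI[of _ c] exI[of _ g] exI[of _ "g'(e := f e)"] conjI c' 1 2 3)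
  qed
qed

text \<open>Add up the parities over \<open>C\<close>: modulo 2, the number of defects in
  \<open>C\<close> depends on \<open>f\<close> only through the number of edges choosing inside
  \<open>C\<close>.\<close>

lemma odd_card_defects_Int:
  assumes "finite E" "finite C"
  shows "odd (card (defects E t f \<inter> C)) \<longleftrightarrow> odd (card {e \<in> E. f e \<in> C} + sum t C)"
  using assms(2)
proof (induction C rule: finite_induct)
  case (insert w C)
  have 1: "{e \<in> E. f e \<in> insert w C} = {e \<in> E. f e = w} \<union> {e \<in> E. f e \<in> C}" by auto
  have 2: "card {e \<in> E. f e \<in> insert w C} = card {e \<in> E. f e = w} + card {e \<in> E. f e \<in> C}"
    unfolding 1 using assms(1) insert.hyps by (intro card_Un_disjoint) auto
  show ?case
  proof (cases "w \<in> defects E t f")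
    case True
    then have "defects E t f \<inter> insert w C = insert w (defects E t f \<inter> C)" by auto
    moreover have "odd (card {e \<in> E. f e = w} + t w)" using True by (simp add: defects_def)
    ultimately show ?thesis using insert 2 by auto
  next
    case False
    then have "defects E t f \<inter> insert w C = defects E t f \<inter> C" by auto
    moreover have "even (card {e \<in> E. f e = w} + t w)" using False by (simp add: defects_def)
    ultimately show ?thesis using insert 2 by auto
  qed
qed simp

text \<open>The value \<open>Inr e\<close> means that \<open>e\<close> selects none of its vertices; it makes \<open>e\<close> itself defective
when \<open>t\<close> is extended by \<open>0\<close> to edges.\<close>

definition selection :: "'e set \<Rightarrow> ('e \<Rightarrow> 'v set) \<Rightarrow> ('e \<Rightarrow> 'v + 'e) \<Rightarrow> bool" where
  "selection E inc f \<longleftrightarrow> (\<forall>e\<in>E. f e \<in> insert (Inr e) (Inl ` inc e))"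

lemma defects_subset:
  assumes "selection E inc f" "\<forall>e\<in>E. inc e \<subseteq> V" "\<forall>v. v \<notin> V \<longrightarrow> t v = 0"
  shows "defects E (case_sum t (\<lambda>_. 0)) f \<subseteq> Inl ` V \<union> Inr ` E"
proof
  fix w assume w: "w \<in> defects E (case_sum t (\<lambda>_. 0)) f"
  show "w \<in> Inl ` V \<union> Inr ` E"
  proof (cases "\<exists>e\<in>E. f e = w")
    case True
    then show ?thesis using assms unfolding selection_def by blast
  next
    case False
    then have "card {e\<in>E. f e = w} = 0" by (metis (mono_tags, lifting) card.empty empty_Collect_eq)
    then have "odd (case_sum t (\<lambda>_. 0) w :: nat)" using w unfolding defects_def by simp
    then obtain v where w: "w = Inl v" and "odd (t v)" by (cases w) simp_all
    then have "v \<in> V" using assms(3) by (metis even_zero)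
    then show ?thesis using w by simp
  qed
qed

text \<open>A parity obstruction: edges inside \<open>C\<close> can select only vertices of
  \<open>C\<close> or themselves, and no other edge selects in \<open>C\<close>, so oddness forces a
  defect at a vertex of \<open>C\<close> or at an edge inside \<open>C\<close>.\<close>

definition odd_block :: "'e set \<Rightarrow> ('e \<Rightarrow> 'v set) \<Rightarrow> ('v \<Rightarrow> nat) \<Rightarrow> 'v set \<Rightarrow> bool" where
  "odd_block E inc t C \<longleftrightarrow> (\<forall>e\<in>E. inc e \<subseteq> C \<or> inc e \<inter> C = {}) \<and>
     odd (card {e \<in> E. inc e \<subseteq> C} + sum t C)"

definition min_selection :: "'e set \<Rightarrow> ('e \<Rightarrow> 'v set) \<Rightarrow> ('v \<Rightarrow> nat) \<Rightarrow> ('e \<Rightarrow> 'v + 'e) \<Rightarrow> bool" where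
  "min_selection E inc t f \<longleftrightarrow>
     is_arg_min (\<lambda>f. card (defects E (case_sum t (\<lambda>_. 0)) f)) (selection E inc) f"

section \<open>Minimal selections and the barrier theorem\<close>

lemma card_swap:
  assumes "finite A" "c \<in> A" "y \<notin> A"
  shows "card (insert y (A - {c})) = card A"
  using assms by (metis Diff_iff card_Suc_Diff1 card_insert_disjoint finite_Diff)

text \<open>The analogue of Gallai's lemma on factor-critical graphs. The minimal defect sets are the bases of
a matroid; being parallel in it is an equivalence relation, an edge is parallel to each of its vertices,
and the blocks are the parallel classes of the elements of one basis.\<close>

lemma critical_blocks:
  fixes V :: "'v set" and E :: "'e set" and inc :: "'e \<Rightarrow> 'v set" and t :: "'v \<Rightarrow> nat"
  defines "T \<equiv> defects E (case_sum t (\<lambda>_. 0)) :: ('e \<Rightarrow> 'v + 'e) \<Rightarrow> ('v + 'e) set"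
  assumes fin: "finite V" "finite E" and inc: "\<forall>e\<in>E. inc e \<subseteq> V \<and> inc e \<noteq> {}"
    and t: "\<forall>v. v \<notin> V \<longrightarrow> t v = 0"
    and crit: "\<forall>e\<in>E. \<exists>f. min_selection E inc t f \<and> Inr e \<in> T f"
    and f0: "min_selection E inc t f0"
  shows "\<exists>K. K \<subseteq> Pow V \<and> pairwise disjnt K \<and> card K = card (T f0) \<and> (\<forall>C\<in>K. odd_block E inc t C)"
proof -
  let ?M = "min_selection E inc t"
  have M_sel: "selection E inc f" if "?M f" for f
    using that by (simp add: min_selection_def is_arg_min_def)
  have M_le: "card (T f) \<le> card (T g)" if "?M f" "selection E inc g" for f g
    using that by (auto simp: min_selection_def is_arg_min_def T_def not_less)
  have M_I: "?M g" if "?M f" "selection E inc g" "card (T g) = card (T f)" for f g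
    using that by (auto simp: min_selection_def is_arg_min_def T_def)
  have sub: "T f \<subseteq> Inl ` V \<union> Inr ` E" if "selection E inc f" for f
    unfolding T_def using that inc t by (intro defects_subset) auto
  have finT: "finite (T f)" if "selection E inc f" for f
    using sub[OF that] fin by (meson finite_Un finite_imageI finite_subset)
  \<comment> \<open>\<open>D\<close> holds the non-loops of the matroid whose bases are the minimal
    defect sets; \<open>P\<close> is parallelism, where distinct elements share no basis.\<close>
  define D where "D = {x. \<exists>f. ?M f \<and> x \<in> T f}"
  define P where "P x y \<longleftrightarrow> x \<in> D \<and> y \<in> D \<and> (x = y \<or> (\<forall>f. ?M f \<longrightarrow> \<not> (x \<in> T f \<and> y \<in> T f)))" for x y
  have P_sym: "P y x" if "P x y" for x y using that unfolding P_def by blast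
  have P_trans: "P x z" if xy: "P x y" and yz: "P y z" for x y z
  proof (rule ccontr)
    assume n: "\<not> P x z"
    then obtain f where f: "?M f" "x \<in> T f" "z \<in> T f" and xz: "x \<noteq> z"
      using xy yz unfolding P_def by blast
    have ne: "x \<noteq> y" "y \<noteq> z" using n xy yz by auto
    then have "y \<notin> T f" using xy f unfolding P_def by blast
    obtain f' where f': "?M f'" "y \<in> T f'" using xy unfolding P_def D_def by blast
    obtain c g g' where c: "c \<noteq> y" "c \<in> sym_diff (T f) (T f')"
      and g: "\<forall>e\<in>E. g e \<in> {f e, f' e} \<and> g' e \<in> {f e, f' e}"
      and Tg: "T g = sym_diff (T f) {y, c}" "T g' = sym_diff (T f') {y, c}"
      using defects_exchange[OF fin(2), of y "case_sum t (\<lambda>_. 0)" f f'] f'(2) \<open>y \<notin> T f\<close>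
      unfolding T_def by blast
    have sg: "selection E inc g" "selection E inc g'"
    proof -
      have "g e \<in> insert (Inr e) (Inl ` inc e) \<and> g' e \<in> insert (Inr e) (Inl ` inc e)" if "e \<in> E" for e
      proof -
        have "{f e, f' e} \<subseteq> insert (Inr e) (Inl ` inc e)"
          using M_sel[OF f(1)] M_sel[OF f'(1)] that unfolding selection_def by blast
        then show ?thesis using g that by blast
      qed
      then show "selection E inc g" "selection E inc g'" unfolding selection_def by blast+
    qed
    \<comment> \<open>If \<open>c\<close> leaves \<open>T f\<close>, the new basis contains
      \<open>y\<close> and still \<open>x\<close> or \<open>z\<close>, against parallelism.
      Otherwise \<open>c\<close> lies in \<open>T f'\<close>, and dropping both \<open>y\<close> and
      \<open>c\<close> from it beats the minimum.\<close>
    show False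
    proof (cases "c \<in> T f")
      case True
      then have "T g = insert y (T f - {c})" using Tg \<open>y \<notin> T f\<close> by auto
      then have "card (T g) = card (T f)" and y: "y \<in> T g" and xz': "x \<in> T g \<or> z \<in> T g"
        using card_swap[OF finT[OF M_sel[OF f(1)]] True \<open>y \<notin> T f\<close>] f xz by auto
      then have "?M g" using M_I[OF f(1) sg(1)] by simp
      then show False using xy yz ne y xz' unfolding P_def by blast
    next
      case False
      then have "T g' \<subset> T f'" using Tg c f'(2) by auto
      then have "card (T g') < card (T f')" using finT[OF M_sel[OF f'(1)]] by (rule psubset_card_mono[rotated])
      then show False using M_le[OF f'(1) sg(2)] by simp
    qed
  qed
  have P_cong: "P x z \<longleftrightarrow> P y z" if "P x y" for x y z
    using P_trans[OF that] P_trans[OF P_sym[OF that]] by auto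
  have P_inc: "P (Inr e) (Inl v)" if e: "e \<in> E" and v: "v \<in> inc e" for e v
  proof -
    \<comment> \<open>Redirecting \<open>e\<close> from itself to \<open>v\<close> moves the defect
      from \<open>e\<close> to \<open>v\<close>. Had \<open>v\<close> been defective too, both
      defects would vanish, against minimality; so the new selection is again minimal and
      \<open>v\<close> is defective in it.\<close>
    have key: "Inl v \<notin> T f \<and> Inl v \<in> D" if f: "?M f" "Inr e \<in> T f" for f
    proof -
      have "f e = Inr e"
      proof (rule ccontr)
        assume "f e \<noteq> Inr e"
        then have "f e' \<noteq> Inr e" if "e' \<in> E" for e'
        proof -
          have "f e' \<in> insert (Inr e') (Inl ` inc e')" using M_sel[OF f(1)] that unfolding selection_def by blast
          then show ?thesis using \<open>f e \<noteq> Inr e\<close> by auto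
        qed
        then have "card {e' \<in> E. f e' = Inr e} = 0" by (metis (mono_tags, lifting) card.empty empty_Collect_eq)
        then show False using f(2) unfolding T_def defects_def by simp
      qed
      let ?g = "f(e := Inl v)"
      have Tg: "T ?g = sym_diff (T f) {Inr e, Inl v}"
        unfolding T_def using defects_upd[OF fin(2) e, of f "Inl v"] \<open>f e = Inr e\<close> by simp
      have sg: "selection E inc ?g" using M_sel[OF f(1)] v unfolding selection_def by auto
      have fT: "finite (T f)" using finT M_sel f by blast
      have "Inl v \<notin> T f"
      proof
        assume "Inl v \<in> T f"
        then have "T ?g \<subset> T f" using Tg f(2) by auto
        then have "card (T ?g) < card (T f)" using fT by (rule psubset_card_mono[rotated])
        then show False using M_le[OF f(1) sg] by simp
      qed
      then have "T ?g = insert (Inl v) (T f - {Inr e})" using Tg f(2) by auto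
      then have "card (T ?g) = card (T f)" "Inl v \<in> T ?g"
        using card_swap[OF fT f(2) \<open>Inl v \<notin> T f\<close>] by auto
      then show ?thesis using M_I[OF f(1) sg] \<open>Inl v \<notin> T f\<close> unfolding D_def by blast
    qed
    obtain f where "?M f" "Inr e \<in> T f" using crit e by blast
    then show ?thesis using key unfolding P_def D_def by blast
  qed
  have D_sub: "D \<subseteq> Inl ` V \<union> Inr ` E" using sub M_sel unfolding D_def by blast
  have T0_D: "T f0 \<subseteq> D" using f0 unfolding D_def by blast
  have P_refl: "P x x" if "x \<in> D" for x using that unfolding P_def by simp
  \<comment> \<open>Only the vertices of the class of \<open>x\<close> are kept: its edges are
    recovered as the edges inside \<open>B x\<close>, since each edge is parallel to its
    vertices.\<close>
  define B where "B x = {v. P (Inl v) x}" for x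
  have B_inc: "inc e \<subseteq> B x \<longleftrightarrow> P (Inr e) x" "inc e \<subseteq> B x \<or> inc e \<inter> B x = {}" if "e \<in> E" for e x
  proof -
    have *: "v \<in> B x \<longleftrightarrow> P (Inr e) x" if "v \<in> inc e" for v
      using P_cong[OF P_inc[OF \<open>e \<in> E\<close> that]] unfolding B_def by simp
    then show "inc e \<subseteq> B x \<longleftrightarrow> P (Inr e) x" "inc e \<subseteq> B x \<or> inc e \<inter> B x = {}"
      using inc \<open>e \<in> E\<close> by blast+
  qed
  have B_V: "B x \<subseteq> V" for x using D_sub unfolding B_def P_def by auto
  have odd: "odd_block E inc t (B x)" if x: "x \<in> T f0" for x
  proof -
    let ?C = "{w. P w x}"
    have C: "?C = Inl ` B x \<union> Inr ` {e \<in> E. P (Inr e) x}"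
    proof -
      have "w \<in> Inl ` B x \<union> Inr ` {e \<in> E. P (Inr e) x}" if "P w x" for w
        using that D_sub unfolding B_def by (cases w) (auto simp: P_def)
      then show ?thesis unfolding B_def by auto
    qed
    have finB: "finite (B x)" using B_V fin finite_subset by blast
    then have finC: "finite ?C" using C fin by simp
    \<comment> \<open>A basis meets the parallel class of one of its elements in that element only;
      this is the source of the oddness.\<close>
    have "T f0 \<inter> ?C = {x}" using x f0 P_refl T0_D unfolding P_def by auto
    then have "odd (card (T f0 \<inter> ?C))" by simp
    then have "odd (card {e \<in> E. f0 e \<in> ?C} + sum (case_sum t (\<lambda>_. 0)) ?C)"
      unfolding T_def using odd_card_defects_Int[OF fin(2) finC] by blast
    moreover have "sum (case_sum t (\<lambda>_. 0)) ?C = sum t (B x)"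
      unfolding C using finB fin by (subst sum.union_disjoint) (auto simp: sum.reindex)
    \<comment> \<open>An edge selects itself or one of its vertices, all in its own class, so it
      selects inside \<open>?C\<close> exactly if it lies inside \<open>B x\<close>.\<close>
    moreover have "{e \<in> E. f0 e \<in> ?C} = {e \<in> E. inc e \<subseteq> B x}"
    proof -
      have "P (f0 e) x \<longleftrightarrow> P (Inr e) x" if e: "e \<in> E" for e
      proof -
        have "f0 e \<in> insert (Inr e) (Inl ` inc e)" using M_sel[OF f0] e unfolding selection_def by blast
        then show ?thesis using P_cong[OF P_inc[OF e]] by auto
      qed
      then show ?thesis using B_inc(1) by auto
    qed
    ultimately show ?thesis using B_inc unfolding odd_block_def by simp
  qed
  have B_ne: "B x \<noteq> {}" if x: "x \<in> T f0" for x
  proof -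
    have "x \<in> Inl ` V \<union> Inr ` E" "x \<in> D" using x T0_D D_sub by blast+
    then show ?thesis
    proof (elim UnE imageE)
      fix e assume e: "x = Inr e" "e \<in> E"
      then have "inc e \<subseteq> B x" using B_inc(1) P_refl \<open>x \<in> D\<close> by simp
      then show ?thesis using inc e by blast
    qed (use P_refl in \<open>auto simp: B_def\<close>)
  qed
  have B_disj: "disjnt (B x) (B y)" if "x \<in> T f0" "y \<in> T f0" "x \<noteq> y" for x y
  proof -
    have "\<not> P x y" using that f0 unfolding P_def by blast
    then have "\<not> (P w x \<and> P w y)" for w using P_sym[of w x] P_trans[of x w y] by blast
    then show ?thesis unfolding B_def disjnt_def by blast
  qed
  have "inj_on B (T f0)"
    using B_ne B_disj by (metis disjnt_self_iff_empty inj_onI)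
  then have "card (B ` T f0) = card (T f0)" by (rule card_image)
  moreover have "pairwise disjnt (B ` T f0)" using B_disj unfolding pairwise_def by blast
  ultimately show ?thesis using B_V odd by (intro exI[of _ "B ` T f0"]) blast
qed

text \<open>Induction on \<open>E\<close> with \<open>t\<close> fixed, which is why the demand is
  not tied to degrees. If every edge is defective in some minimal selection, the parallel classes
  serve with \<open>A\<close> empty. Otherwise an edge \<open>e\<close> that never is goes into
  \<open>A\<close>, paid for by a defect that is saved when \<open>e\<close> is present.\<close>

lemma selection_barrier:
  fixes inc :: "'e \<Rightarrow> 'v set" and t :: "'v \<Rightarrow> nat"
  assumes "finite V" "finite E" "\<forall>e\<in>E. inc e \<subseteq> V \<and> inc e \<noteq> {}" "\<forall>v. v \<notin> V \<longrightarrow> t v = 0"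
  shows "\<exists>f A K. selection E inc f \<and> A \<subseteq> E \<and> K \<subseteq> Pow V \<and> pairwise disjnt K \<and>
    (\<forall>C\<in>K. odd_block (E - A) inc t C) \<and>
    card A + card (defects E (case_sum t (\<lambda>_. 0)) f) \<le> card K"
  using assms(2,3)
proof (induction E rule: finite_psubset_induct)
  case (psubset E)
  let ?T = "\<lambda>E. defects E (case_sum t (\<lambda>_. 0)) :: ('e \<Rightarrow> 'v + 'e) \<Rightarrow> ('v + 'e) set"
  have "selection E inc Inr" by (simp add: selection_def)
  then have "\<exists>f. min_selection E inc t f"
    unfolding min_selection_def is_arg_min_linorder
    using ex_has_least_nat[of "selection E inc" Inr "\<lambda>f. card (?T E f)"] by blast
  then obtain f0 where f0: "min_selection E inc t f0" ..
  then have sf0: "selection E inc f0" by (simp add: min_selection_def is_arg_min_def)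
  show ?case
  proof (cases "\<forall>e\<in>E. \<exists>f. min_selection E inc t f \<and> Inr e \<in> ?T E f")
    case True
    from critical_blocks[OF assms(1) psubset.hyps(1) psubset.prems assms(4) True f0]
    obtain K where "K \<subseteq> Pow V" "pairwise disjnt K" "card K = card (?T E f0)" "\<forall>C\<in>K. odd_block E inc t C" by blast
    then show ?thesis using sf0 by (intro exI[of _ f0] exI[of _ "{}"] exI[of _ K]) simp
  next
    case False
    then obtain e where e: "e \<in> E" "\<And>f. min_selection E inc t f \<Longrightarrow> Inr e \<notin> ?T E f" by blast
    obtain f A K where f: "selection (E - {e}) inc f" and A: "A \<subseteq> E - {e}" and K: "K \<subseteq> Pow V" "pairwise disjnt K"
      "\<forall>C\<in>K. odd_block (E - {e} - A) inc t C" "card A + card (?T (E - {e}) f) \<le> card K"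
      using psubset.IH[of "E - {e}"] e psubset.prems by blast
    \<comment> \<open>Letting \<open>e\<close> select nothing adds exactly the defect
      \<open>e\<close>, so by the choice of \<open>e\<close> this extension is not minimal.\<close>
    let ?g = "f(e := Inr e)"
    have sg: "selection E inc ?g" using f by (auto simp: selection_def)
    have f0e: "f d \<noteq> Inr e" if "d \<in> E - {e}" for d
    proof -
      have "f d \<in> insert (Inr d) (Inl ` inc d)" using f that unfolding selection_def by blast
      then show ?thesis using that by auto
    qed
    have Tg: "?T E ?g = insert (Inr e) (?T (E - {e}) f)"
    proof -
      have 1: "{e' \<in> E. ?g e' = Inr e} = {e}" "{e' \<in> E - {e}. f e' = Inr e} = {}"
        using f0e e by auto
      have 2: "{e' \<in> E. ?g e' = w} = {e' \<in> E - {e}. f e' = w}" if "w \<noteq> Inr e" for w using that by auto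
      have "w \<in> ?T E ?g \<longleftrightarrow> w \<in> insert (Inr e) (?T (E - {e}) f)" for w
        by (cases "w = Inr e") (use 1 2[of w] in \<open>auto simp: defects_def\<close>)
      then show ?thesis by blast
    qed
    have notin: "Inr e \<notin> ?T (E - {e}) f"
    proof -
      have "card {e' \<in> E - {e}. f e' = Inr e} = 0" using f0e by (metis (mono_tags, lifting) card.empty empty_Collect_eq)
      then show ?thesis by (simp add: defects_def)
    qed
    let ?U = "Inl ` V \<union> Inr ` E :: ('v + 'e) set"
    have U: "finite ?U" using assms(1) psubset.hyps by simp
    have sub: "?T E h \<subseteq> ?U" if "selection E inc h" for h
      using that psubset.prems assms(4) by (intro defects_subset) auto
    \<comment> \<open>Counting over all vertices and edges shows that all selections have the same
      parity of defects.\<close>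
    have par: "odd (card (?T E h)) \<longleftrightarrow> odd (card E + sum (case_sum t (\<lambda>_. 0)) ?U)" if "selection E inc h" for h
    proof -
      have "?T E h \<inter> ?U = ?T E h" using sub[OF that] by blast
      moreover have "{e \<in> E. h e \<in> ?U} = E" using that psubset.prems unfolding selection_def by blast
      ultimately show ?thesis using odd_card_defects_Int[OF psubset.hyps(1) U, of "case_sum t (\<lambda>_. 0)" h] by simp
    qed
    have "finite (?T E ?g)" using sub[OF sg] U finite_subset by blast
    then have cg: "card (?T E ?g) = Suc (card (?T (E - {e}) f))" using notin unfolding Tg by simp
    have "\<not> min_selection E inc t ?g" using e(2) Tg by blast
    then have "card (?T E f0) < card (?T E ?g)"
      using f0 sg unfolding min_selection_def is_arg_min_linorder by (meson leI order_trans)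
    moreover have "odd (card (?T E f0)) \<longleftrightarrow> odd (card (?T E ?g))" using par sf0 sg by blast
    \<comment> \<open>Fewer with equal parity means at least two fewer than \<open>?g\<close>, hence
      at least one fewer than \<open>f\<close>; this makes up for the edge added to
      \<open>A\<close>.\<close>
    ultimately have "Suc (card (?T E f0)) \<le> card (?T (E - {e}) f)"
      using cg by (metis Suc_leI even_Suc less_Suc_eq)
    moreover have "card (insert e A) = Suc (card A)"
      using A psubset.hyps finite_subset[OF A] by (subst card_insert_disjoint) auto
    moreover have "E - insert e A = E - {e} - A" by blast
    ultimately show ?thesis using sf0 e A K by (intro exI[of _ f0] exI[of _ "insert e A"] exI[of _ K]) auto
  qed
qed

subsection \<open>Euler families of even graphs\<close>

text \<open>Pairing each edge with the vertex it leads to keeps edges and anchors aligned when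
  trails are cut and appended. The function \<open>g\<close> gives the ends of an edge in a
  graph.\<close>

fun trail :: "'e set \<Rightarrow> ('e \<Rightarrow> 'v set) \<Rightarrow> 'v \<Rightarrow> ('e \<times> 'v) list \<Rightarrow> 'v \<Rightarrow> bool" where
  "trail S g a [] b \<longleftrightarrow> a = b"
| "trail S g a ((e, c) # p) b \<longleftrightarrow> e \<in> S \<and> g e = {a, c} \<and> a \<noteq> c \<and> e \<notin> fst ` set p \<and> trail S g c p b"

lemma trail_append:
  "trail S g a (p @ q) b \<longleftrightarrow>
    (\<exists>c. trail S g a p c \<and> trail S g c q b) \<and> fst ` set p \<inter> fst ` set q = {}"
proof (induction p arbitrary: a)
  case (Cons x p)
  obtain e c where "x = (e, c)" by (cases x)
  then show ?case using Cons.IH[of c] by (simp add: image_Un) blast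
qed simp

lemma trail_edges: "trail S g a p b \<Longrightarrow> fst ` set p \<subseteq> S"
  by (induction S g a p b rule: trail.induct) simp_all

lemma trail_distinct: "trail S g a p b \<Longrightarrow> distinct (map fst p)"
  by (induction S g a p b rule: trail.induct) simp_all

lemma trail_last: "trail S g a p b \<Longrightarrow> last (a # map snd p) = b"
  by (induction p arbitrary: a) auto

lemma trail_anchors:
  assumes "trail S g a p b" "p \<noteq> []"
  shows "insert a (snd ` set p) = \<Union> (g ` fst ` set p)"
  using assms
proof (induction p arbitrary: a)
  case (Cons x p)
  then show ?case by (cases x; cases "p = []") auto
qed simp

lemma trail_nth:
  assumes "trail S g a p b" "i < length p"
  shows "g (map fst p ! i) = {(a # map snd p) ! i, (a # map snd p) ! Suc i} \<and>
    (a # map snd p) ! i \<noteq> (a # map snd p) ! Suc i"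
  using assms
proof (induction p arbitrary: a i)
  case (Cons x p)
  then show ?case by (cases x; cases i) auto
qed simp

text \<open>Each passage through \<open>v\<close> uses two edges; only a start or an end at
  \<open>v\<close> contributes a single one.\<close>

lemma trail_degree:
  assumes "trail S g a p b"
  shows "odd (card {e \<in> fst ` set p. v \<in> g e}) \<longleftrightarrow> (v = a) \<noteq> (v = b)"
  using assms
proof (induction p arbitrary: a)
  case (Cons x p)
  obtain e c where x: "x = (e, c)" by (cases x)
  have e: "g e = {a, c}" "a \<noteq> c" "e \<notin> fst ` set p" and t: "trail S g c p b" using Cons.prems x by auto
  show ?case
  proof (cases "v \<in> {a, c}")
    case True
    then have "{e' \<in> fst ` set (x # p). v \<in> g e'} = insert e {e' \<in> fst ` set p. v \<in> g e'}"
      using e x by auto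
    moreover have "e \<notin> {e' \<in> fst ` set p. v \<in> g e'}" using e by blast
    ultimately have "card {e' \<in> fst ` set (x # p). v \<in> g e'} = Suc (card {e' \<in> fst ` set p. v \<in> g e'})"
      by simp
    then show ?thesis using Cons.IH[OF t] True e by auto
  next
    case False
    then have "{e' \<in> fst ` set (x # p). v \<in> g e'} = {e' \<in> fst ` set p. v \<in> g e'}" using e x by auto
    then show ?thesis using Cons.IH[OF t] False by auto
  qed
qed simp

text \<open>Cut the trail just after it reaches \<open>v\<close> and interchange the two
  pieces.\<close>

lemma closed_trail_rotate:
  assumes "trail S g a p a" "v \<in> insert a (snd ` set p)"
  shows "\<exists>q. trail S g v q v \<and> set q = set p \<and> length q = length p"
proof (cases "v = a")
  case False
  then obtain e where "(e, v) \<in> set p" using assms(2) by force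
  then obtain q r where p: "p = q @ (e, v) # r" by (meson split_list)
  then have p': "p = (q @ [(e, v)]) @ r" by simp
  have "trail S g a (q @ [(e, v)]) v" "trail S g v r a" and d: "fst ` set (q @ [(e, v)]) \<inter> fst ` set r = {}"
    using assms(1) unfolding p' trail_append by auto
  then have "trail S g v (r @ q @ [(e, v)]) v" unfolding trail_append by auto
  then show ?thesis using p by (intro exI[of _ "r @ q @ [(e, v)]"]) auto
qed (use assms in blast)

lemma trail_closed_strict_trail:
  assumes t: "trail S g a p a" and p: "p \<noteq> []" and S: "S \<subseteq> E"
    and g: "\<forall>e\<in>S. g e \<subseteq> inc e" and inc: "\<forall>e\<in>E. inc e \<subseteq> V"
  shows "closed_strict_trail V E inc (a # map snd p) (map fst p)"
proof -
  have e: "fst ` set p \<subseteq> S" using trail_edges[OF t] .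
  have "set (a # map snd p) \<subseteq> V"
  proof -
    have "set (a # map snd p) = \<Union> (g ` fst ` set p)" using trail_anchors[OF t p] by simp
    moreover have "g e \<subseteq> V" if "e \<in> fst ` set p" for e
      using that e S g inc by (meson subset_iff)
    ultimately show ?thesis by (simp add: UN_subset_iff)
  qed
  moreover have "(a # map snd p) ! i \<noteq> (a # map snd p) ! Suc i \<and> (a # map snd p) ! i \<in> inc (map fst p ! i)
      \<and> (a # map snd p) ! Suc i \<in> inc (map fst p ! i)" if "i < length p" for i
  proof -
    have "map fst p ! i \<in> S" using e that by auto
    then show ?thesis using trail_nth[OF t that] g by blast
  qed
  moreover have "length p \<noteq> Suc 0"
  proof
    assume "length p = Suc 0"
    then obtain x where "p = [x]" by (metis length_0_conv length_Suc_conv)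
    then show False using t by (cases x) auto
  qed
  then have "2 \<le> length p" using p by (cases p) (auto simp: Suc_le_eq)
  ultimately show ?thesis
    using trail_distinct[OF t] trail_last[OF t] e S
    unfolding closed_strict_trail_def closed_walk_def walk_def by auto
qed

lemma exists_saturated_closed_trail:
  assumes fin: "finite S" and ne: "S \<noteq> {}" and g: "\<forall>e\<in>S. card (g e) = 2"
    and even: "\<forall>v. even (card {e \<in> S. v \<in> g e})"
  shows "\<exists>a p. p \<noteq> [] \<and> trail S g a p a \<and> (\<forall>e\<in>S. e \<in> fst ` set p \<or> g e \<inter> insert a (snd ` set p) = {})"
proof -
  let ?Q = "\<lambda>n. \<exists>a p b. trail S g a p b \<and> length p = n"
  have pair: "\<exists>w. g e = {v, w} \<and> v \<noteq> w" if "e \<in> S" "v \<in> g e" for e v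
  proof -
    have "card (g e) = 2" using g that(1) by blast
    then obtain x y where xy: "g e = {x, y}" "x \<noteq> y" by (metis card_2_iff)
    have "v \<in> {x, y}" using that(2) xy(1) by simp
    then consider "v = x" | "v = y" by blast
    then show ?thesis
    proof cases
      case 1
      then show ?thesis using xy by blast
    next
      case 2
      then show ?thesis using xy by (intro exI[of _ x]) auto
    qed
  qed
  obtain e0 where e0: "e0 \<in> S" using ne by blast
  then have "g e0 \<noteq> {}" using g by fastforce
  then obtain v0 where "v0 \<in> g e0" by blast
  with pair e0 obtain w0 where w0: "g e0 = {v0, w0}" "v0 \<noteq> w0" by blast
  have len: "length p \<le> card S" if "trail S g a p b" for a p b
    using trail_edges[OF that] trail_distinct[OF that] fin
    by (metis card_mono distinct_card length_map set_map)
  have "?Q 0" by (intro exI[of _ v0] exI[of _ "[]"]) simp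
  moreover have "\<forall>n. ?Q n \<longrightarrow> n \<le> card S" using len by blast
  ultimately have "\<exists>n. ?Q n \<and> (\<forall>m. ?Q m \<longrightarrow> m \<le> n)" by (rule Nat.ex_has_greatest_nat)
  then obtain a p b where t: "trail S g a p b"
    and max: "\<And>a' p' b'. trail S g a' p' b' \<Longrightarrow> length p' \<le> length p" by blast
  have "p \<noteq> []"
  proof
    assume "p = []"
    moreover have "trail S g v0 [(e0, w0)] w0" using e0 w0 by simp
    ultimately show False using max[of v0 "[(e0, w0)]" w0] by simp
  qed
  have "a = b"
  proof (rule ccontr)
    assume "a \<noteq> b"
    then have "odd (card {e \<in> fst ` set p. b \<in> g e})" using trail_degree[OF t] by blast
    then have "{e \<in> fst ` set p. b \<in> g e} \<noteq> {e \<in> S. b \<in> g e}" using even by metis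
    then obtain e where e: "e \<in> S" "e \<notin> fst ` set p" "b \<in> g e" using trail_edges[OF t] by blast
    with pair obtain w where "g e = {b, w}" "b \<noteq> w" by blast
    then have "trail S g a (p @ [(e, w)]) w" unfolding trail_append using e t by auto
    then show False using max[of a "p @ [(e, w)]" w] by simp
  qed
  have "g e \<inter> insert a (snd ` set p) = {}" if e: "e \<in> S" "e \<notin> fst ` set p" for e
  proof (rule ccontr)
    assume "g e \<inter> insert a (snd ` set p) \<noteq> {}"
    then obtain v where v: "v \<in> g e" "v \<in> insert a (snd ` set p)" by blast
    obtain q where q: "trail S g v q v" "set q = set p" "length q = length p"
      using closed_trail_rotate t \<open>a = b\<close> v(2) by metis
    obtain w where "g e = {v, w}" "v \<noteq> w" using pair e(1) v(1) by blast
    then have "trail S g v (q @ [(e, w)]) w" unfolding trail_append using e q by auto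
    then show False using max[of v "q @ [(e, w)]" w] q(3) by simp
  qed
  then show ?thesis using t \<open>p \<noteq> []\<close> \<open>a = b\<close> by blast
qed

section \<open>Decomposition of even graphs into anchor-disjoint closed trails\<close>

lemma closed_walk_anchors:
  assumes "closed_walk V E inc vs es"
  shows "set vs \<subseteq> \<Union> (inc ` set es)"
proof
  fix v assume "v \<in> set vs"
  then obtain i where i: "i < length vs" "vs ! i = v" by (metis in_set_conv_nth)
  have w: "walk V E inc vs es" "2 \<le> length es" using assms by (auto simp: closed_walk_def)
  show "v \<in> \<Union> (inc ` set es)"
  proof (cases "i < length es")
    case True
    then have "v \<in> inc (es ! i)" "es ! i \<in> set es" using w i by (auto simp: walk_def)
    then show ?thesis by blast
  next
    \<comment> \<open>The final anchor precedes no edge; it lies in the last edge, which exists as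
      the walk has at least two.\<close>
    case False
    then have "i = Suc (length es - 1)" using w i by (auto simp: walk_def)
    then have "v \<in> inc (es ! (length es - 1))" "es ! (length es - 1) \<in> set es" using w i by (auto simp: walk_def)
    then show ?thesis by blast
  qed
qed

text \<open>Serves both to enlarge the edge set in the induction below and to pass from a graph of
  vertex pairs to the hypergraph.\<close>

lemma closed_strict_trail_mono:
  assumes "closed_strict_trail V S g vs es" "S \<subseteq> E" "\<forall>e\<in>S. g e \<subseteq> inc e"
  shows "closed_strict_trail V E inc vs es"
  using assms unfolding closed_strict_trail_def closed_walk_def walk_def
  by (meson nth_mem subset_iff)

text \<open>Split off a saturated closed trail. It has even degree everywhere, so the rest is even
  again; by saturation the remaining edges avoid its anchors, hence so do the trails found by
  induction.\<close>

lemma even_graph_euler_family: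
  assumes "finite S" "\<forall>e\<in>S. card (g e) = 2" "\<forall>e\<in>S. g e \<subseteq> V" "\<forall>v. even (card {e \<in> S. v \<in> g e})"
  shows "\<exists>F. euler_family V S g F"
  using assms
proof (induction S rule: finite_psubset_induct)
  case (psubset S)
  show ?case
  proof (cases "S = {}")
    case True
    then show ?thesis by (auto simp: euler_family_def intro: exI[of _ "{}"])
  next
    case False
    obtain a p where p: "p \<noteq> []" and t: "trail S g a p a"
      and sat: "\<forall>e\<in>S. e \<in> fst ` set p \<or> g e \<inter> insert a (snd ` set p) = {}"
      using exists_saturated_closed_trail[OF psubset.hyps(1) False psubset.prems(1,3)] by blast
    define X where "X = fst ` set p"
    let ?R = "S - X"
    let ?T = "(a # map snd p, map fst p)"
    have X: "X \<subseteq> S" "X \<noteq> {}" using trail_edges[OF t] p by (simp_all add: X_def)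
    then have "?R \<subset> S" by blast
    moreover have "even (card {e \<in> ?R. v \<in> g e})" for v
    proof -
      have "{e \<in> ?R. v \<in> g e} = {e \<in> S. v \<in> g e} - {e \<in> X. v \<in> g e}" by blast
      moreover have "{e \<in> X. v \<in> g e} \<subseteq> {e \<in> S. v \<in> g e}" using X(1) by blast
      moreover have "finite {e \<in> X. v \<in> g e}" using finite_subset[OF X(1) psubset.hyps(1)] by simp
      ultimately have "card {e \<in> ?R. v \<in> g e} = card {e \<in> S. v \<in> g e} - card {e \<in> X. v \<in> g e}"
        by (simp add: card_Diff_subset)
      then show ?thesis using psubset.prems(3) trail_degree[OF t, of v, folded X_def] by simp
    qed
    ultimately obtain F where F: "euler_family V ?R g F" using psubset.IH[of ?R] psubset.prems by blast
    have T: "closed_strict_trail V S g (fst ?T) (snd ?T)"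
      using trail_closed_strict_trail[OF t p] psubset.prems(2) by simp
    have setT: "set (snd ?T) = X" by (simp add: X_def)
    have F_trail: "closed_strict_trail V ?R g (fst U) (snd U)" if "U \<in> F" for U
      using F that by (simp add: euler_family_def)
    have F_edges: "set (snd U) \<subseteq> ?R" if "U \<in> F" for U
      using F_trail[OF that] by (auto simp: closed_strict_trail_def closed_walk_def walk_def)
    have F_disj: "set (fst U) \<inter> set (fst ?T) = {}" if "U \<in> F" for U
    proof -
      have "closed_walk V ?R g (fst U) (snd U)"
        using F_trail[OF that] by (simp add: closed_strict_trail_def)
      then have "set (fst U) \<subseteq> \<Union> (g ` set (snd U))" by (rule closed_walk_anchors)
      also have "\<dots> \<subseteq> \<Union> (g ` ?R)" by (rule UN_mono[OF F_edges[OF that] order_refl])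
      finally have sub: "set (fst U) \<subseteq> \<Union> (g ` ?R)" .
      have disj: "g e \<inter> set (fst ?T) = {}" if "e \<in> ?R" for e
        using sat that unfolding X_def[symmetric] by auto
      have "x \<notin> set (fst ?T)" if x: "x \<in> set (fst U)" for x
      proof -
        obtain e where e: "e \<in> ?R" "x \<in> g e" using subsetD[OF sub x] by (elim UN_E)
        show ?thesis using disj[OF e(1)] e(2) unfolding disjoint_iff by (elim allE impE)
      qed
      then show ?thesis unfolding disjoint_iff by (intro allI impI)
    qed
    have c1: "\<forall>U\<in>insert ?T F. closed_strict_trail V S g (fst U) (snd U)"
    proof
      fix U assume "U \<in> insert ?T F"
      then show "closed_strict_trail V S g (fst U) (snd U)"
        using T closed_strict_trail_mono[OF F_trail, of U S g] by auto
    qed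
    have c2: "\<exists>!U. U \<in> insert ?T F \<and> e \<in> set (snd U)" if "e \<in> S" for e
    proof (cases "e \<in> X")
      case True
      then show ?thesis using F_edges by (intro ex1I[of _ ?T]) (auto simp: setT simp del: snd_conv)
    next
      case False
      then have "\<exists>!U. U \<in> F \<and> e \<in> set (snd U)" using F that by (auto simp: euler_family_def)
      then show ?thesis using False setT by (metis insert_iff)
    qed
    have c3: "\<forall>U1\<in>insert ?T F. \<forall>U2\<in>insert ?T F. U1 \<noteq> U2 \<longrightarrow> set (fst U1) \<inter> set (fst U2) = {}"
    proof -
      have "set (fst U1) \<inter> set (fst U2) = {}" if "U1 \<in> F" "U2 \<in> F" "U1 \<noteq> U2" for U1 U2
        using F that unfolding euler_family_def by blast
      then show ?thesis using F_disj by blast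
    qed
    show ?thesis
      unfolding euler_family_def by (rule exI, rule conjI[OF c1 conjI[OF ballI[OF c2] c3]])
  qed
qed

subsection \<open>Cut edges\<close>

lemma connected_by_walk_sym:
  assumes "connected_by_walk V E inc u v"
  shows "connected_by_walk V E inc v u"
proof -
  obtain vs es where w: "walk V E inc vs es" "hd vs = u" "last vs = v"
    using assms by (auto simp: connected_by_walk_def)
  have ne: "vs \<noteq> []" using w by (auto simp: walk_def)
  have "walk V E inc (rev vs) (rev es)"
    unfolding walk_def
  proof (intro conjI allI impI)
    fix i assume "i < length (rev es)"
    then have i: "i < length es" by simp
    let ?j = "length es - Suc i"
    have l: "length vs = Suc (length es)" using w by (simp add: walk_def)
    have j: "?j < length es" using i by simp
    have "rev vs ! i = vs ! Suc ?j" "rev vs ! Suc i = vs ! ?j" "rev es ! i = es ! ?j"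
      using i l by (simp_all add: rev_nth Suc_diff_Suc)
    then show "rev vs ! i \<noteq> rev vs ! Suc i" "rev vs ! i \<in> inc (rev es ! i)" "rev vs ! Suc i \<in> inc (rev es ! i)"
      using w(1) j unfolding walk_def by metis+
  qed (use w in \<open>auto simp: walk_def\<close>)
  then show ?thesis using w ne unfolding connected_by_walk_def
    by (metis hd_rev last_rev)
qed

lemma connected_by_walk_trans:
  assumes "connected_by_walk V E inc u v" "connected_by_walk V E inc v w"
  shows "connected_by_walk V E inc u w"
proof -
  obtain vs es where 1: "walk V E inc vs es" "hd vs = u" "last vs = v"
    using assms by (auto simp: connected_by_walk_def)
  obtain ws fs where 2: "walk V E inc ws fs" "hd ws = v" "last ws = w"
    using assms by (auto simp: connected_by_walk_def)
  have ne: "vs \<noteq> []" and ws: "ws \<noteq> []" and lb: "length (butlast vs) = length es"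
    using 1 2 by (auto simp: walk_def)
  have vs: "vs = butlast vs @ [v]" using append_butlast_last_id[OF ne] 1(3) by simp
  \<comment> \<open>The joint \<open>v\<close> ends the first list and starts the second, so one
    copy is dropped; at index \<open>length es\<close> both readings agree.\<close>
  have *: "(butlast vs @ ws) ! i = vs ! i" if "i \<le> length es" for i
  proof (cases "i = length es")
    case True
    then have "(butlast vs @ ws) ! i = v" "(butlast vs @ [v]) ! i = v"
      using lb 2(2) ws by (simp_all add: nth_append hd_conv_nth)
    then show ?thesis using vs by simp
  next
    case False
    then show ?thesis using that lb by (simp add: nth_append nth_butlast)
  qed
  have **: "(butlast vs @ ws) ! i = ws ! (i - length es)" if "i \<ge> length es" for i
    using that lb by (simp add: nth_append)
  have "walk V E inc (butlast vs @ ws) (es @ fs)"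
    unfolding walk_def
  proof (intro conjI allI impI)
    fix i assume i: "i < length (es @ fs)"
    have "(butlast vs @ ws) ! i \<noteq> (butlast vs @ ws) ! Suc i \<and> (butlast vs @ ws) ! i \<in> inc ((es @ fs) ! i) \<and>
      (butlast vs @ ws) ! Suc i \<in> inc ((es @ fs) ! i)"
    proof (cases "i < length es")
      case True
      then show ?thesis using 1 *[of i] *[of "Suc i"] by (simp add: walk_def nth_append)
    next
      case False
      then show ?thesis using i 2 **[of i] **[of "Suc i"] by (simp add: walk_def nth_append Suc_diff_le)
    qed
    then show "(butlast vs @ ws) ! i \<noteq> (butlast vs @ ws) ! Suc i" "(butlast vs @ ws) ! i \<in> inc ((es @ fs) ! i)"
      "(butlast vs @ ws) ! Suc i \<in> inc ((es @ fs) ! i)" by blast+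
  qed (use 1 2 lb in \<open>auto simp: walk_def dest: in_set_butlastD\<close>)
  moreover have "hd (butlast vs @ ws) = u" using 1 2 vs by (metis append_Nil hd_append list.sel(1))
  moreover have "last (butlast vs @ ws) = w" using 2 ws by simp
  ultimately show ?thesis unfolding connected_by_walk_def by blast
qed

lemma connected_by_walk_cong:
  assumes "connected_by_walk V E inc u v"
  shows "connected_by_walk V E inc u w \<longleftrightarrow> connected_by_walk V E inc v w"
  using connected_by_walk_trans[OF assms] connected_by_walk_trans[OF connected_by_walk_sym[OF assms]]
  by (rule iffI[rotated])

lemma connected_by_walk_refl: "v \<in> V \<Longrightarrow> connected_by_walk V E inc v v"
  unfolding connected_by_walk_def by (intro exI[of _ "[v]"] exI[of _ "[]"]) (simp add: walk_def)

lemma connected_by_walk_edge: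
  assumes "e \<in> E" "u \<in> inc e" "v \<in> inc e" "inc e \<subseteq> V"
  shows "connected_by_walk V E inc u v"
proof (cases "u = v")
  case False
  then show ?thesis
    unfolding connected_by_walk_def using assms
    by (intro exI[of _ "[u, v]"] exI[of _ "[e]"]) (auto simp: walk_def)
next
  case True
  have "u \<in> V" using assms(2,4) by blast
  then show ?thesis using True connected_by_walk_refl[of v V E inc] by simp
qed

lemma connected_by_walk_mono:
  "connected_by_walk V E inc u v \<Longrightarrow> E \<subseteq> E' \<Longrightarrow> connected_by_walk V E' inc u v"
  unfolding connected_by_walk_def walk_def by blast

lemma connected_by_walk_closed:
  assumes "connected_by_walk V E inc u v" "u \<in> C" "\<forall>e\<in>E. inc e \<subseteq> C \<or> inc e \<inter> C = {}"
  shows "v \<in> C"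
proof -
  obtain vs es where w: "walk V E inc vs es" "hd vs = u" "last vs = v"
    using assms by (auto simp: connected_by_walk_def)
  have ne: "vs \<noteq> []" and l: "length vs = Suc (length es)" using w by (auto simp: walk_def)
  have "i \<le> length es \<Longrightarrow> vs ! i \<in> C" for i
  proof (induction i)
    case 0
    then show ?case using w assms(2) ne by (simp add: hd_conv_nth)
  next
    case (Suc i)
    then have "vs ! i \<in> inc (es ! i)" "vs ! Suc i \<in> inc (es ! i)" "es ! i \<in> E"
      using w(1) unfolding walk_def by (auto simp: subset_iff)
    then show ?case using assms(3) Suc by fastforce
  qed
  then show ?thesis using w l ne by (metis diff_Suc_1 last_conv_nth le_refl)
qed

text \<open>Sending each component of H - e to the component of H containing it is onto and
  identifies those of \<open>v\<close> and \<open>w\<close>. These differ in H - e because a walk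
  avoiding \<open>e\<close> cannot leave \<open>C\<close>.\<close>

lemma cut_edgeI:
  assumes fin: "finite V" and e: "e \<in> E" "inc e \<subseteq> V" and C: "\<forall>d\<in>E - {e}. inc d \<subseteq> C \<or> inc d \<inter> C = {}"
    and v: "v \<in> inc e" "v \<in> C" and w: "w \<in> inc e" "w \<notin> C"
  shows "cut_edge V E inc e"
proof -
  let ?c = "\<lambda>E u. {x \<in> V. connected_by_walk V E inc u x}"
  \<comment> \<open>On a component of H - e this union is the single component of H containing
    it.\<close>
  let ?h = "\<lambda>K. \<Union> (?c E ` K)"
  have h: "?h (?c (E - {e}) u) = ?c E u" if "u \<in> V" for u
  proof -
    have "u \<in> ?c (E - {e}) u" using that connected_by_walk_refl by simp
    moreover have "?c E x = ?c E u" if "x \<in> ?c (E - {e}) u" for x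
    proof -
      have "connected_by_walk V E inc u x" using that connected_by_walk_mono[of V "E - {e}" inc u x E] by blast
      then show ?thesis using connected_by_walk_cong[of V E inc u x] by simp
    qed
    ultimately show ?thesis by (intro UN_constant_eq ballI)
  qed
  have im: "?c E ` V = ?h ` ?c (E - {e}) ` V" unfolding image_image using h by simp
  have vw: "v \<in> V" "w \<in> V" using v w e by auto
  have "?c E v = ?c E w"
    using connected_by_walk_cong[OF connected_by_walk_edge[of e E v inc w V, OF e(1) v(1) w(1) e(2)]] by simp
  then have "?h (?c (E - {e}) v) = ?h (?c (E - {e}) w)" using h vw by simp
  moreover have "?c (E - {e}) v \<noteq> ?c (E - {e}) w"
  proof
    assume "?c (E - {e}) v = ?c (E - {e}) w"
    moreover have "w \<in> ?c (E - {e}) w" using connected_by_walk_refl[OF vw(2)] vw(2) by simp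
    ultimately have "w \<in> ?c (E - {e}) v" by (rule ssubst)
    then have "connected_by_walk V (E - {e}) inc v w" by simp
    then have "w \<in> C" using connected_by_walk_closed v(2) C by metis
    then show False using w(2) by contradiction
  qed
  ultimately have "\<not> inj_on ?h (?c (E - {e}) ` V)" using vw unfolding inj_on_def by blast
  then have "card (?h ` ?c (E - {e}) ` V) < card (?c (E - {e}) ` V)"
    using fin by (meson card_image_le eq_card_imp_inj_on finite_imageI le_neq_implies_less)
  then show ?thesis using e(1) im unfolding cut_edge_def num_components_def by simp
qed

subsection \<open>3-uniform hypergraphs\<close>

lemma sum_degree:
  assumes "finite C" "finite E"
  shows "(\<Sum>v\<in>C. card {e \<in> E. v \<in> inc e}) = (\<Sum>e\<in>E. card (inc e \<inter> C))"
proof (rule sum_multicount_gen[OF assms])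
  have "{v \<in> C. v \<in> inc e} = inc e \<inter> C" for e by blast
  then show "\<forall>e\<in>E. card {v \<in> C. v \<in> inc e} = card (inc e \<inter> C)" by simp
qed

text \<open>An edge inside \<open>C\<close> and outside \<open>A\<close> counts 3 in the degree sum
  and once more in \<open>odd_block\<close>, an even total; the other edges outside \<open>A\<close>
  miss \<open>C\<close>. So the oddness must come from \<open>A\<close>.\<close>

lemma odd_block_degree:
  assumes fin: "finite C" "finite E" and u: "\<forall>e\<in>E. card (inc e) = 3" and A: "A \<subseteq> E"
    and C: "odd_block (E - A) inc (\<lambda>v. card {e \<in> E. v \<in> inc e}) C"
  shows "odd (\<Sum>e\<in>A. card (inc e \<inter> C))"
proof -
  let ?I = "{e \<in> E - A. inc e \<subseteq> C}"
  have *: "card (inc e \<inter> C) = (if inc e \<subseteq> C then 3 else 0)" if e: "e \<in> E - A" for e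
  proof (cases "inc e \<subseteq> C")
    case True
    then show ?thesis using u e by (simp add: Int_absorb2)
  next
    case False
    then have "inc e \<inter> C = {}" using C e unfolding odd_block_def by blast
    then show ?thesis using False by simp
  qed
  have "(\<Sum>e\<in>E - A. card (inc e \<inter> C)) = (\<Sum>e\<in>E - A. if inc e \<subseteq> C then 3 else 0)"
    by (rule sum.cong[OF refl *])
  also have "\<dots> = (\<Sum>e\<in>?I. 3)"
    using fin by (intro sum.inter_filter[symmetric]) simp
  finally have 1: "(\<Sum>e\<in>E - A. card (inc e \<inter> C)) = 3 * card ?I" by simp
  have "(\<Sum>v\<in>C. card {e \<in> E. v \<in> inc e}) = (\<Sum>e\<in>E - A. card (inc e \<inter> C)) + (\<Sum>e\<in>A. card (inc e \<inter> C))"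
    unfolding sum_degree[OF fin] using sum.subset_diff[OF A fin(2)] .
  then show ?thesis using C 1 unfolding odd_block_def by simp
qed

lemma few_odd_blocks:
  assumes fin: "finite V" "finite E" and inc: "\<forall>e\<in>E. inc e \<subseteq> V" and u: "\<forall>e\<in>E. card (inc e) = 3"
    and no_cut: "\<forall>e\<in>E. \<not> cut_edge V E inc e" and A: "A \<subseteq> E"
    and K: "K \<subseteq> Pow V" "pairwise disjnt K"
      "\<forall>C\<in>K. odd_block (E - A) inc (\<lambda>v. card {e \<in> E. v \<in> inc e}) C"
  shows "card K \<le> card A"
proof -
  have finA: "finite A" using A fin finite_subset by blast
  have finC: "finite C" if "C \<in> K" for C using that K fin by (meson PowD finite_subset subsetD)
  have finK: "finite K" using K fin by (meson finite_Pow_iff finite_subset)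
  have three: "3 \<le> (\<Sum>e\<in>A. card (inc e \<inter> C))" if C: "C \<in> K" for C
  proof -
    have ob: "odd_block (E - A) inc (\<lambda>v. card {e \<in> E. v \<in> inc e}) C" using C K by blast
    have "odd (\<Sum>e\<in>A. card (inc e \<inter> C))" using odd_block_degree[OF finC[OF C] fin(2) u A ob] .
    \<comment> \<open>With a single incidence, at an edge \<open>e\<close>, no other edge crosses
      the boundary of \<open>C\<close>, while \<open>e\<close> has three vertices and so leaves
      \<open>C\<close>. Thus \<open>e\<close> is a cut edge.\<close>
    moreover have "(\<Sum>e\<in>A. card (inc e \<inter> C)) \<noteq> 1"
    proof
      assume "(\<Sum>e\<in>A. card (inc e \<inter> C)) = 1"
      then have "\<exists>e\<in>A. card (inc e \<inter> C) = 1 \<and> (\<forall>d\<in>A. e \<noteq> d \<longrightarrow> card (inc d \<inter> C) = 0)"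
        using sum_eq_1_iff[OF finA, of "\<lambda>e. card (inc e \<inter> C)"] by simp
      then obtain e where e: "e \<in> A" "card (inc e \<inter> C) = 1"
        and others: "\<forall>d\<in>A. e \<noteq> d \<longrightarrow> card (inc d \<inter> C) = 0" by (elim bexE conjE)
      have eE: "e \<in> E" using e A by blast
      obtain v where v: "inc e \<inter> C = {v}" using e(2) by (meson card_1_singletonE)
      have "\<not> inc e \<subseteq> C"
      proof
        assume "inc e \<subseteq> C"
        then have "inc e \<inter> C = inc e" by blast
        then show False using e(2) u eE by simp
      qed
      then obtain w where w: "w \<in> inc e" "w \<notin> C" by blast
      have "inc d \<subseteq> C \<or> inc d \<inter> C = {}" if d: "d \<in> E - {e}" for d
      proof (cases "d \<in> A")
        case True
        then show ?thesis using others d finC[OF C] by auto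
      next
        case False
        then show ?thesis using d ob unfolding odd_block_def by blast
      qed
      then have "cut_edge V E inc e"
        using cut_edgeI[OF fin(1) eE, of inc C v w] inc eE v w by blast
      then show False using no_cut eE by blast
    qed
    ultimately show ?thesis by presburger
  qed
  have le: "(\<Sum>C\<in>K. card (inc e \<inter> C)) \<le> 3" if e: "e \<in> A" for e
  proof -
    have fe: "finite (inc e)" using e A inc fin by (meson finite_subset subsetD)
    have "card (\<Union>C\<in>K. inc e \<inter> C) = (\<Sum>C\<in>K. card (inc e \<inter> C))"
    proof (rule card_UN_disjoint[OF finK])
      show "\<forall>C\<in>K. \<forall>D\<in>K. C \<noteq> D \<longrightarrow> (inc e \<inter> C) \<inter> (inc e \<inter> D) = {}"
        using K(2) unfolding pairwise_def disjnt_def by blast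
    qed (use fe in simp)
    moreover have "card (\<Union>C\<in>K. inc e \<inter> C) \<le> card (inc e)" using fe by (intro card_mono) auto
    ultimately show ?thesis using u e A by auto
  qed
  have "3 * card K = (\<Sum>C\<in>K. 3)" by simp
  also have "\<dots> \<le> (\<Sum>C\<in>K. \<Sum>e\<in>A. card (inc e \<inter> C))" using three by (intro sum_mono)
  also have "\<dots> = (\<Sum>e\<in>A. \<Sum>C\<in>K. card (inc e \<inter> C))" by (rule sum.swap)
  also have "\<dots> \<le> (\<Sum>e\<in>A. 3)" using le by (intro sum_mono)
  also have "\<dots> = 3 * card A" by simp
  finally show ?thesis by simp
qed

text \<open>Drop the selected vertex from each edge. A degree in the resulting graph is the degree
  in the hypergraph minus the number of omissions, which is even as no vertex is defective.\<close>

lemma perfect_selection_euler_family: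
  assumes fin: "finite E" and inc: "\<forall>e\<in>E. inc e \<subseteq> V" and u: "\<forall>e\<in>E. card (inc e) = 3"
    and f: "selection E inc f"
    and perfect: "defects E (case_sum (\<lambda>v. card {e \<in> E. v \<in> inc e}) (\<lambda>_. 0)) f = {}"
  shows "\<exists>F. euler_family V E inc F"
proof -
  have even: "even (card {e \<in> E. f e = w} + case_sum (\<lambda>v. card {e \<in> E. v \<in> inc e}) (\<lambda>_. 0) w)" for w
    using perfect unfolding defects_def by blast
  have f_Inl: "f e \<in> Inl ` inc e" if e: "e \<in> E" for e
  proof (rule ccontr)
    assume n: "f e \<notin> Inl ` inc e"
    have mem: "f d \<in> insert (Inr d) (Inl ` inc d)" if "d \<in> E" for d
      using f that unfolding selection_def by blast
    have "d = e" if "d \<in> E" "f d = Inr e" for d using mem[OF that(1)] that(2) by auto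
    moreover have "f e = Inr e" using mem[OF e] n by auto
    \<comment> \<open>Only \<open>e\<close> can select \<open>Inr e\<close>, where the demand is 0,
      so an edge selecting nothing would be a defect.\<close>
    ultimately have "{d \<in> E. f d = Inr e} = {e}" using e by auto
    then show False using even[of "Inr e"] by simp
  qed
  define g where "g e = inc e - {projl (f e)}" for e
  have h: "projl (f e) \<in> inc e" "f e = Inl (projl (f e))" if "e \<in> E" for e using f_Inl[OF that] by auto
  have "card (g e) = 2" if e: "e \<in> E" for e
    using h(1)[OF e] u e unfolding g_def by simp
  moreover have "even (card {e \<in> E. v \<in> g e})" for v
  proof -
    have "{e \<in> E. v \<in> inc e} = {e \<in> E. v \<in> g e} \<union> {e \<in> E. f e = Inl v}"
    proof -
      have "v \<in> inc e \<longleftrightarrow> v \<in> g e \<or> f e = Inl v" if "e \<in> E" for e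
        using h[OF that] unfolding g_def by (metis DiffE DiffI singletonD sum.sel(1))
      then show ?thesis by blast
    qed
    moreover have "{e \<in> E. v \<in> g e} \<inter> {e \<in> E. f e = Inl v} = {}" unfolding g_def by auto
    ultimately have "card {e \<in> E. v \<in> inc e} = card {e \<in> E. v \<in> g e} + card {e \<in> E. f e = Inl v}"
      using fin by (simp add: card_Un_disjoint)
    moreover have "even (card {e \<in> E. f e = Inl v} + card {e \<in> E. v \<in> inc e})"
      using even[of "Inl v"] by simp
    ultimately show ?thesis by presburger
  qed
  moreover have sub: "\<forall>e\<in>E. g e \<subseteq> inc e" unfolding g_def by blast
  ultimately obtain F where F: "euler_family V E g F"
    using even_graph_euler_family[OF fin, of g V] inc by (meson order_trans)
  then have "euler_family V E inc F"
    using closed_strict_trail_mono[OF _ order_refl sub] unfolding euler_family_def by blast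
  then show ?thesis by blast
qed

theorem theorem2p33:
  fixes V :: "'v set" and E :: "'e set" and inc :: "'e \<Rightarrow> 'v set"
  assumes "hypergraph V E inc"
    and "three_uniform E inc"
    and "\<forall>e\<in>E. \<not> cut_edge V E inc e"
  shows "quasi_eulerian V E inc"
proof -
  let ?t = "\<lambda>v. card {e \<in> E. v \<in> inc e}"
  have fin: "finite V" "finite E" and inc: "\<forall>e\<in>E. inc e \<subseteq> V"
    using assms(1) by (auto simp: hypergraph_def)
  have u: "\<forall>e\<in>E. card (inc e) = 3" using assms(2) by (simp add: three_uniform_def)
  have inc': "\<forall>e\<in>E. inc e \<subseteq> V \<and> inc e \<noteq> {}" using inc u by fastforce
  have t: "\<forall>v. v \<notin> V \<longrightarrow> ?t v = 0"
  proof (intro allI impI)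
    fix v assume "v \<notin> V"
    then have "{e \<in> E. v \<in> inc e} = {}" using inc by blast
    then show "?t v = 0" by (simp only: card.empty)
  qed
  obtain f A K where f: "selection E inc f" and A: "A \<subseteq> E"
    and K: "K \<subseteq> Pow V" "pairwise disjnt K" "\<forall>C\<in>K. odd_block (E - A) inc ?t C"
    and le: "card A + card (defects E (case_sum ?t (\<lambda>_. 0)) f) \<le> card K"
    using selection_barrier[OF fin inc' t] by blast
  have "card (defects E (case_sum ?t (\<lambda>_. 0)) f) = 0"
    using le few_odd_blocks[OF fin inc u assms(3) A K] by simp
  \<comment> \<open>Cardinality 0 alone would also allow an infinite set.\<close>
  moreover have "finite (defects E (case_sum ?t (\<lambda>_. 0)) f)"
    by (rule finite_subset[OF defects_subset[OF f inc t]]) (use fin in simp)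
  ultimately show ?thesis
    using perfect_selection_euler_family[OF fin(2) inc u f] unfolding quasi_eulerian_def by simp
qed
end
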